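(* For every $\tau\in\mathbb{H}^2$, $$\frac{\theta'[\frac15,\frac75]}{\theta[\frac15,\frac75]}=-\zeta_5\,\theta'[1,1]\,\frac{\theta^5[\frac15,\frac75]-3\zeta_5^3\,\theta^5[\frac35,\frac15]}{10\,\theta^3[\frac15,\frac75]\,\theta^3[\frac35,\frac15]},\qquad \frac{\theta'[\frac35,\frac15]}{\theta[\frac35,\frac15]}=-\zeta_5\,\theta'[1,1]\,\frac{3\,\theta^5[\frac15,\frac75]+\zeta_5^3\,\theta^5[\frac35,\frac15]}{10\,\theta^3[\frac15,\frac75]\,\theta^3[\frac35,\frac15]}.$$
   Context: $\mathbb{H}^2=\{\tau\in\mathbb{C} : \Im\tau>0\}$ is the upper half plane and $\zeta_k=\exp(2\pi i/k)$. For $\epsilon,\epsilon'\in\mathbb{R}$, $\zeta\in\mathbb{C}$, $\tau\in\mathbb{H}^2$, the theta function with characteristics is $$\theta[\epsilon,\epsilon'](\zeta,\tau)=\sum_{n\in\mathbb{Z}}\exp\left(2\pi i\left[\tfrac12\left(n+\tfrac{\epsilon}{2}\right)^2\tau+\left(n+\tfrac{\epsilon}{2}\right)\left(\zeta+\tfrac{\epsilon'}{2}\right)\right]\right).$$ Write $\theta[\epsilon,\epsilon']=\theta[\epsilon,\epsilon'](0,\tau)$ and $\theta'[\epsilon,\epsilon']=\frac{\partial}{\partial\zeta}\theta[\epsilon,\epsilon'](\zeta,\tau)\big|_{\zeta=0}$; $\theta^k[\epsilon,\epsilon']$ means the $k$-th power of $\theta[\epsilon,\epsilon']$. *)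

theory Defs
  imports "HOL-Analysis.Analysis"
begin

definition root_zeta :: "nat \<Rightarrow> complex" where
  "root_zeta k = exp (2 * complex_of_real pi * \<i> / of_nat k)"

text \<open>The argument order is that of \<open>\<theta>[\<epsilon>, \<epsilon>'](\<zeta>, \<tau>)\<close>. For \<open>Im \<tau> > 0\<close> the series over the
  integers converges absolutely; otherwise the value is of no interest.\<close>

definition theta_char :: "real \<Rightarrow> real \<Rightarrow> complex \<Rightarrow> complex \<Rightarrow> complex" where
  "theta_char \<epsilon> \<epsilon>' \<zeta> \<tau> =
     (\<Sum>\<^sub>\<infinity>n\<in>(UNIV :: int set).
        exp (2 * complex_of_real pi * \<i> *
          (1 / 2 * (of_int n + complex_of_real \<epsilon> / 2) ^ 2 * \<tau>
           + (of_int n + complex_of_real \<epsilon> / 2) * (\<zeta> + complex_of_real \<epsilon>' / 2))))"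

definition theta_const :: "real \<Rightarrow> real \<Rightarrow> complex \<Rightarrow> complex" where
  "theta_const \<epsilon> \<epsilon>' \<tau> = theta_char \<epsilon> \<epsilon>' 0 \<tau>"

definition theta_deriv_const :: "real \<Rightarrow> real \<Rightarrow> complex \<Rightarrow> complex" where
  "theta_deriv_const \<epsilon> \<epsilon>' \<tau> = deriv (\<lambda>\<zeta>. theta_char \<epsilon> \<epsilon>' \<zeta> \<tau>) 0"

end

theory Submission
  imports Defs "HOL-Complex_Analysis.Complex_Analysis"
begin

text \<open>
  Let \<open>\<theta>\<close> be the odd theta function \<open>\<theta>[1, 1]\<close> and \<open>Z = \<theta>'/\<theta>\<close>. Up to explicit exponential factors, the theta
  constants with characteristics \<open>(1/5, 7/5)\<close> and \<open>(3/5, 1/5)\<close> are \<open>A \<sim> \<theta>(2 w)\<close> and \<open>B \<sim> \<theta>(w)\<close>, where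
  \<open>w = (\<tau> + 2) / 5\<close> is a 5-torsion point, and their logarithmic derivatives are \<open>- Z(2 w)\<close> and \<open>- Z(w)\<close>
  up to additive constants. Both are governed by
  \<open>2 Z(y) - Z(y + u) - Z(y - u) = - \<theta>'(0) \<theta>(2 y) \<theta>(u)\<^sup>2 / (\<theta>(y)\<^sup>2 \<theta>(y + u) \<theta>(y - u))\<close>,
  which is the theta form of the formula for \<open>\<wp>'(y) / (\<wp>(y) - \<wp>(u))\<close> in the Weierstrass theory
  (\<open>log_deriv_theta_identity\<close>). For \<open>(y, u) = (w, 2 w)\<close> and \<open>(2 w, w)\<close> quasi-periodicity reduces the
  multiples \<open>3 w\<close> and \<open>4 w\<close> to \<open>- 2 w\<close> and \<open>- w\<close>. This leaves two linear equations,
  \<open>A'/A + 3 B'/B = - \<zeta>\<^sub>5 \<theta>'(0) A\<^sup>2 / B\<^sup>3\<close> and \<open>B'/B - 3 A'/A = - \<zeta>\<^sub>5\<^sup>4 \<theta>'(0) B\<^sup>2 / A\<^sup>3\<close>,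
  and solving them gives the theorem.

  The relation for \<open>Z\<close> comes from the series alone. A rearrangement of the double series
  writes \<open>\<theta>(x + y) \<theta>(x - y)\<close> as the determinant \<open>g(x) h(y) - h(x) g(y)\<close> of two theta functions for
  \<open>2 \<tau>\<close> (\<open>odd_theta_product\<close>), and the relation follows by differentiating this in \<open>x\<close> and applying a
  Pluecker identity.

  Division requires \<open>\<theta>(w) \<noteq> 0\<close> and \<open>\<theta>(2 w) \<noteq> 0\<close>. The product formula also yields this: at a zero \<open>w\<close> the vectors
  \<open>(g, h)\<close> at \<open>s + w\<close> and at \<open>s\<close> are parallel, which forces \<open>\<theta>(p + w) = C exp (\<mu> p) \<theta>(p)\<close>, and the periods
  \<open>1\<close> and \<open>\<tau>\<close> then put \<open>w\<close> in the lattice \<open>\<int> \<tau> + \<int>\<close> (\<open>odd_theta_zeros_lattice\<close>).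
\<close>

section \<open>The theta series\<close>

text \<open>The second characteristic is a translation of \<open>z\<close> and is absorbed into that argument
  (\<open>theta_char_eq_series\<close>); only the first characteristic is kept, halved.\<close>

definition theta_term :: "real \<Rightarrow> complex \<Rightarrow> complex \<Rightarrow> int \<Rightarrow> complex" where
  "theta_term a z t n = exp (\<i> * pi * ((of_int n + of_real a)\<^sup>2 * t + 2 * (of_int n + of_real a) * z))"

definition theta_series :: "real \<Rightarrow> complex \<Rightarrow> complex \<Rightarrow> complex" where
  "theta_series a z t = (\<Sum>\<^sub>\<infinity>n. theta_term a z t n)"

lemma theta_char_eq_series:
  "theta_char \<epsilon> \<epsilon>' z t = theta_series (\<epsilon> / 2) (z + of_real \<epsilon>' / 2) t"
  unfolding theta_char_def theta_series_def theta_term_def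
  by (intro infsum_cong arg_cong[where f = exp]) (simp add: field_simps)

lemma has_sum_geometric_nonzero_int:
  fixes r :: real
  assumes "0 \<le> r" "r < 1"
  shows "((\<lambda>n::int. r ^ nat \<bar>n\<bar>) has_sum (2 * r / (1 - r))) (- {0})"
proof -
  have *: "((\<lambda>n. r ^ n) has_sum (r / (1 - r))) {1..}"
    using assms by (intro has_sum_geometric_from_1) auto
  have pos: "((\<lambda>n::int. r ^ nat \<bar>n\<bar>) has_sum (r / (1 - r))) {1..}"
    using * by (subst has_sum_reindex_bij_witness[of _ int nat "{1..}" "\<lambda>n. r ^ n"]) auto
  have neg: "((\<lambda>n::int. r ^ nat \<bar>n\<bar>) has_sum (r / (1 - r))) {..-1}"
    using * by (subst has_sum_reindex_bij_witness[of _ "\<lambda>n. - int n" "\<lambda>n. nat (-n)" "{1..}" "\<lambda>n. r ^ n"]) auto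
  have "((\<lambda>n::int. r ^ nat \<bar>n\<bar>) has_sum (r / (1 - r) + r / (1 - r))) ({1..} \<union> {..-1})"
    by (rule has_sum_Un_disjoint[OF pos neg]) auto
  also have "{1..} \<union> {..-1} = - {0::int}" by auto
  finally show ?thesis by simp
qed

lemma norm_theta_term:
  "norm (theta_term a z t n) = exp (- pi * ((of_int n + a)\<^sup>2 * Im t + 2 * (of_int n + a) * Im z))"
proof -
  have "of_int n + of_real a = complex_of_real (of_int n + a)" by simp
  then show ?thesis
    unfolding theta_term_def norm_exp_eq_Re
    by (simp only: flip: of_real_power) (simp add: algebra_simps)
qed

lemma linear_minus_square_bound:
  fixes b c u :: real
  assumes "c > 0"
  shows "b * u - c * u\<^sup>2 \<le> b\<^sup>2 / (4 * c)"
proof -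
  have "0 \<le> (2 * c * u - b)\<^sup>2" by simp
  then have "(b * u - c * u\<^sup>2) * (4 * c) \<le> b\<^sup>2"
    by (simp add: power2_eq_square algebra_simps)
  then show ?thesis using assms by (subst pos_le_divide_eq) simp_all
qed

text \<open>Completing the square, the Gaussian decay in \<open>n\<close> beats the linear exponent coming from \<open>z\<close>,
  so a geometric series in \<open>\<bar>n\<bar>\<close> dominates the terms uniformly on every disc.\<close>

lemma norm_theta_term_le:
  assumes "Im t > 0" "norm z \<le> R"
  shows "norm (theta_term a z t n)
           \<le> exp ((2 * pi * R + 1)\<^sup>2 / (4 * (pi * Im t)) + \<bar>a\<bar>) * exp (-1) ^ nat \<bar>n\<bar>"
proof -
  define u where "u = of_int n + a"
  define K where "K = (2 * pi * R + 1)\<^sup>2 / (4 * (pi * Im t))"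
  have "\<bar>Im z\<bar> \<le> R" using assms(2) abs_Im_le_cmod order_trans by blast
  then have "\<bar>u * Im z\<bar> \<le> \<bar>u\<bar> * R" unfolding abs_mult by (rule mult_left_mono) simp
  then have "- (u * Im z) \<le> \<bar>u\<bar> * R" by linarith
  from mult_left_mono[OF this, of "2 * pi"]
  have 1: "- pi * (2 * u * Im z) \<le> 2 * pi * R * \<bar>u\<bar>" by (simp add: mult_ac)
  have 2: "(2 * pi * R + 1) * \<bar>u\<bar> - pi * Im t * \<bar>u\<bar>\<^sup>2 \<le> K"
    unfolding K_def by (rule linear_minus_square_bound) (simp add: assms)
  have 3: "real_of_int \<bar>n\<bar> \<le> \<bar>u\<bar> + \<bar>a\<bar>" by (simp add: u_def)
  have "- pi * (u\<^sup>2 * Im t + 2 * u * Im z) \<le> K - \<bar>u\<bar>"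
    using 1 2 by (simp add: algebra_simps)
  with 3 have "- pi * (u\<^sup>2 * Im t + 2 * u * Im z) \<le> K + \<bar>a\<bar> + - real_of_int \<bar>n\<bar>" by linarith
  then have "norm (theta_term a z t n) \<le> exp (K + \<bar>a\<bar> + - real_of_int \<bar>n\<bar>)"
    by (simp add: norm_theta_term u_def)
  also have "exp (- real_of_int \<bar>n\<bar>) = exp (-1) ^ nat \<bar>n\<bar>"
    by (simp flip: exp_of_nat_mult)
  then have "exp (K + \<bar>a\<bar> + - real_of_int \<bar>n\<bar>) = exp (K + \<bar>a\<bar>) * exp (-1) ^ nat \<bar>n\<bar>"
    by (simp only: exp_add)
  finally show ?thesis by (simp only: K_def)
qed

lemma theta_term_bound:
  assumes "Im t > 0"
  obtains M where "M summable_on UNIV" "\<And>n z. norm z \<le> R \<Longrightarrow> norm (theta_term a z t n) \<le> M n"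
proof -
  have "(\<lambda>n::int. exp (-1::real) ^ nat \<bar>n\<bar>) summable_on (- {0} \<union> {0})"
    by (intro summable_on_Un_disjoint has_sum_imp_summable[OF has_sum_geometric_nonzero_int]) auto
  then have "(\<lambda>n::int. exp (-1::real) ^ nat \<bar>n\<bar>) summable_on UNIV"
    by (simp only: Compl_partition2)
  from summable_on_cmult_right[OF this] norm_theta_term_le[OF assms] show ?thesis
    by (rule that)
qed

lemma theta_term_norm_summable:
  assumes "Im t > 0"
  shows "(\<lambda>n. norm (theta_term a z t n)) summable_on UNIV"
proof -
  obtain M where M: "M summable_on UNIV" "\<And>n z'. norm z' \<le> norm z \<Longrightarrow> norm (theta_term a z' t n) \<le> M n"
    using theta_term_bound[OF assms] by metis
  show ?thesis by (rule summable_on_comparison_test[OF M(1)]) (simp_all add: M(2))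
qed

lemma theta_term_summable: "Im t > 0 \<Longrightarrow> theta_term a z t summable_on UNIV"
  by (rule abs_summable_summable[OF theta_term_norm_summable])

lemma theta_series_holomorphic:
  assumes "Im t > 0"
  shows "(\<lambda>z. theta_series a z t) holomorphic_on UNIV"
proof -
  have "(\<lambda>z. theta_series a z t) holomorphic_on ball 0 R" for R
  proof -
    obtain M where M: "M summable_on UNIV" "\<And>n z. norm z \<le> R \<Longrightarrow> norm (theta_term a z t n) \<le> M n"
      using theta_term_bound[OF assms] by metis
    have "uniform_limit (cball 0 R) (\<lambda>X z. \<Sum>n\<in>X. theta_term a z t n)
            (\<lambda>z. theta_series a z t) (finite_subsets_at_top UNIV)"
      unfolding theta_series_def using M by (intro Weierstrass_m_test_general[of _ _ _ M]) auto
    moreover have "(\<lambda>z. \<Sum>n\<in>X. theta_term a z t n) holomorphic_on S" for X S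
      unfolding theta_term_def by (intro holomorphic_intros)
    ultimately show ?thesis
      by (elim holomorphic_uniform_limit[rotated])
         (auto intro!: always_eventually holomorphic_on_imp_continuous_on)
  qed
  then have "(\<lambda>z. theta_series a z t) field_differentiable at z" for z
    by (meson holomorphic_on_imp_differentiable_at open_ball mem_ball_0 linordered_field_no_ub)
  then show ?thesis by (simp add: holomorphic_on_def field_differentiable_at_within)
qed

subsection \<open>Translations of the argument\<close>

text \<open>The term-by-term completion of the square. With real \<open>b\<close> it moves any characteristic to any
  other at the price of an exponential factor, so all theta functions here are translates of a
  single one.\<close>

lemma theta_series_add_char:
  "theta_series (a + b) z t =
     exp (\<i> * pi * (of_real b ^ 2 * t + 2 * of_real b * z)) * theta_series a (z + of_real b * t) t"
proof -
  have "theta_term (a + b) z t n =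
      exp (\<i> * pi * (of_real b ^ 2 * t + 2 * of_real b * z)) * theta_term a (z + of_real b * t) t n" for n
    by (simp add: theta_term_def power2_eq_square algebra_simps flip: exp_add)
  then show ?thesis by (simp add: theta_series_def infsum_cmult_right')
qed

lemma theta_series_char_plus_1: "theta_series (a + 1) z t = theta_series a z t"
proof -
  have "theta_term a z t (n + 1) = theta_term (a + 1) z t n" for n
    unfolding theta_term_def by (rule arg_cong[where f = exp]) (simp add: add_ac)
  then show ?thesis
    unfolding theta_series_def
    by (intro infsum_reindex_bij_witness[of _ "\<lambda>n. n - 1" "\<lambda>n. n + 1"]) auto
qed

lemma theta_series_uminus: "theta_series (- a) (- z) t = theta_series a z t"
proof -
  have "theta_term a z t (- n) = theta_term (- a) (- z) t n" for n
    unfolding theta_term_def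
    by (rule arg_cong[where f = exp]) (simp add: power2_eq_square algebra_simps)
  then show ?thesis
    unfolding theta_series_def
    by (intro infsum_reindex_bij_witness[of _ uminus uminus]) auto
qed

lemma exp_2pi_int: "exp (2 * (of_int n * of_real pi * \<i>)) = 1"
  using exp_integer_2pi[of "of_int n"] by (simp add: algebra_simps)

lemma exp_eq_1_imp_2pi_int:
  fixes z :: complex
  assumes "exp z = 1"
  obtains k :: int where "z = of_int (2 * k) * pi * \<i>"
proof -
  from assms obtain k :: int where "Re z = 0" "Im z = of_int (2 * k) * pi"
    unfolding exp_eq_1 by blast
  then show ?thesis by (intro that[of k]) (simp add: complex_eq_iff)
qed

lemma theta_series_plus_1: "theta_series a (z + 1) t = exp (2 * \<i> * pi * a) * theta_series a z t"
proof -
  have "theta_term a (z + 1) t n = exp (2 * \<i> * pi * a) * theta_term a z t n" for n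
  proof -
    have "theta_term a (z + 1) t n = exp (2 * (of_int n * of_real pi * \<i>)) * exp (2 * \<i> * pi * a) * theta_term a z t n"
      unfolding theta_term_def exp_add[symmetric]
      by (rule arg_cong[where f = exp]) (simp add: power2_eq_square algebra_simps)
    then show ?thesis by (simp only: exp_2pi_int) simp
  qed
  then show ?thesis by (simp add: theta_series_def infsum_cmult_right')
qed

subsection \<open>The theta series does not vanish identically\<close>

text \<open>Averaging over \<open>z\<close> and \<open>z + 1/2\<close> keeps the terms with even \<open>n\<close>, which form the series for
  \<open>4 t\<close>. If the series vanished identically for \<open>t\<close>, it would therefore vanish identically for
  \<open>4 ^ k * t\<close>; but when \<open>Im t\<close> is large the term \<open>n = 0\<close> dominates.\<close>

lemma theta_series_average:
  assumes "Im t > 0"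
  shows "theta_series 0 z t + theta_series 0 (z + 1/2) t = 2 * theta_series 0 (2 * z) (4 * t)"
proof -
  have ev: "theta_term 0 z t n + theta_term 0 (z + 1/2) t n = 2 * theta_term 0 (2 * z) (4 * t) (n div 2)"
    if even: "even n" for n
  proof -
    obtain k where k: "n = 2 * k" using even by (rule evenE)
    have *: "theta_term 0 (z + 1/2) t n = theta_term 0 z t n * exp (2 * (of_int k * of_real pi * \<i>))"
      unfolding theta_term_def exp_add[symmetric] k
      by (rule arg_cong[where f = exp]) (simp add: power2_eq_square algebra_simps)
    show ?thesis unfolding * exp_2pi_int by (simp add: theta_term_def k power2_eq_square algebra_simps)
  qed
  have od: "theta_term 0 z t n + theta_term 0 (z + 1/2) t n = 0" if odd: "odd n" for n
  proof -
    obtain k where k: "n = 2 * k + 1" using odd by (rule oddE)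
    have "theta_term 0 (z + 1/2) t n =
            theta_term 0 z t n * exp (2 * (of_int k * of_real pi * \<i>)) * exp (\<i> * pi)"
      unfolding theta_term_def exp_add[symmetric] k
      by (rule arg_cong[where f = exp]) (simp add: power2_eq_square algebra_simps)
    then show ?thesis by (simp only: exp_2pi_int) simp
  qed
  have "theta_series 0 z t + theta_series 0 (z + 1/2) t =
      (\<Sum>\<^sub>\<infinity>n. theta_term 0 z t n + theta_term 0 (z + 1/2) t n)"
    unfolding theta_series_def by (rule infsum_add[symmetric]) (use assms in \<open>auto intro: theta_term_summable\<close>)
  also have "\<dots> = (\<Sum>\<^sub>\<infinity>n\<in>{n. even n}. theta_term 0 z t n + theta_term 0 (z + 1/2) t n)"
    by (rule infsum_cong_neutral) (auto simp: od)
  also have "\<dots> = (\<Sum>\<^sub>\<infinity>n. 2 * theta_term 0 (2 * z) (4 * t) n)"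
    by (rule infsum_reindex_bij_witness[of _ "\<lambda>n. 2 * n" "\<lambda>n. n div 2"]) (auto simp: ev)
  finally show ?thesis by (simp add: theta_series_def infsum_cmult_right')
qed

lemma theta_series_0_nonzero_if_large_Im:
  assumes "Im t \<ge> 1"
  shows "theta_series 0 0 t \<noteq> 0"
proof
  assume 0: "theta_series 0 0 t = 0"
  define r where "r = exp (- pi)"
  \<comment> \<open>\<open>r < 1/4\<close> makes the two geometric tails \<open>2 r / (1 - r)\<close> smaller than the central term 1.\<close>
  have "1 + 3 < exp pi"
    using exp_ge_add_one_self[of pi] pi_gt3 by linarith
  then have r: "0 \<le> r" "r < 1 / 4" "r < 1" by (auto simp: r_def exp_minus field_simps)
  have le: "norm (theta_term 0 0 t n) \<le> r ^ nat \<bar>n\<bar>" if "n \<noteq> 0" for n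
  proof -
    have "real_of_int \<bar>n\<bar> * 1 \<le> (of_int n)\<^sup>2 * Im t"
    proof (rule mult_mono)
      have "\<bar>n\<bar> * 1 \<le> \<bar>n\<bar> * \<bar>n\<bar>" using that by (intro mult_left_mono) auto
      then show "real_of_int \<bar>n\<bar> \<le> (real_of_int n)\<^sup>2"
        by (simp add: power2_eq_square flip: of_int_mult abs_mult)
    qed (use assms in auto)
    then have "exp (- (pi * ((of_int n)\<^sup>2 * Im t))) \<le> exp (- (pi * real_of_int \<bar>n\<bar>))" by simp
    also have "\<dots> = r ^ nat \<bar>n\<bar>" by (simp add: r_def algebra_simps flip: exp_of_nat_mult)
    finally show ?thesis by (simp add: norm_theta_term)
  qed
  have sm: "theta_term 0 0 t summable_on UNIV" "(\<lambda>n. norm (theta_term 0 0 t n)) summable_on UNIV"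
    using assms by (auto intro: theta_term_summable theta_term_norm_summable)
  have geo: "((\<lambda>n::int. r ^ nat \<bar>n\<bar>) has_sum (2 * r / (1 - r))) (- {0})"
    using r by (intro has_sum_geometric_nonzero_int) auto
  have "theta_series 0 0 t = infsum (theta_term 0 0 t) ({0} \<union> - {0})"
    by (simp add: theta_series_def Compl_partition)
  also have "\<dots> = 1 + infsum (theta_term 0 0 t) (- {0})"
    by (subst infsum_Un_disjoint) (auto intro: summable_on_subset_banach[OF sm(1)] simp: theta_term_def)
  finally have "norm (infsum (theta_term 0 0 t) (- {0})) = 1"
    using 0 by (metis add.inverse_inverse add.right_inverse add_eq_0_iff norm_minus_cancel norm_one)
  moreover have "norm (infsum (theta_term 0 0 t) (- {0})) \<le> 2 * r / (1 - r)"
  proof -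
    have s: "(\<lambda>n. norm (theta_term 0 0 t n)) summable_on (- {0})"
      by (rule summable_on_subset_banach[OF sm(2)]) auto
    show ?thesis
      using norm_infsum_bound[OF s] infsum_mono[OF s has_sum_imp_summable[OF geo] le] infsumI[OF geo] by force
  qed
  moreover have "2 * r / (1 - r) < 1" using r by (simp add: field_simps)
  ultimately show False by simp
qed

lemma theta_series_not_identically_0:
  assumes "Im t > 0"
  shows "\<exists>z. theta_series 0 z t \<noteq> 0"
proof (rule ccontr)
  assume "\<not> ?thesis"
  then have 0: "theta_series 0 z t = 0" for z by simp
  have Im: "Im (4 ^ k * t) = 4 ^ k * Im t" for k
    by (induction k) (simp_all add: mult.assoc)
  have *: "theta_series 0 z (4 ^ k * t) = 0" for k z
  proof (induction k arbitrary: z)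
    case (Suc k)
    then show ?case
      using theta_series_average[of "4 ^ k * t" "z / 2"] Im[of k] assms by (simp add: mult.assoc)
  qed (simp add: 0)
  obtain k where "1 / Im t < 4 ^ k" using real_arch_pow[of 4 "1 / Im t"] by auto
  then have "Im (4 ^ k * t) \<ge> 1" using assms by (simp add: Im field_simps)
  then show False using theta_series_0_nonzero_if_large_Im * by blast
qed

lemma has_sum_mult_Times:
  fixes f :: "'a \<Rightarrow> complex" and g :: "'b \<Rightarrow> complex"
  assumes "(\<lambda>x. norm (f x)) summable_on A" "(\<lambda>y. norm (g y)) summable_on B"
  shows "((\<lambda>(x, y). f x * g y) has_sum (infsum f A * infsum g B)) (A \<times> B)"
proof (rule has_sum_SigmaI)
  have f: "(f has_sum infsum f A) A" and g: "(g has_sum infsum g B) B"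
    using assms by (auto intro: has_sum_infsum abs_summable_summable)
  show "((\<lambda>y. case (x, y) of (x, y) \<Rightarrow> f x * g y) has_sum (f x * infsum g B)) B" for x
    using has_sum_cmult_right[OF g] by simp
  show "((\<lambda>x. f x * infsum g B) has_sum (infsum f A * infsum g B)) A"
    by (rule has_sum_cmult_left[OF f])
  have "(\<lambda>p. norm (case p of (x, y) \<Rightarrow> f x * g y)) summable_on A \<times> B"
  proof (rule summable_on_SigmaI)
    show "((\<lambda>y. norm (case (x, y) of (x, y) \<Rightarrow> f x * g y)) has_sum (norm (f x) * (\<Sum>\<^sub>\<infinity>y\<in>B. norm (g y)))) B" for x
      using has_sum_cmult_right[OF has_sum_infsum[OF assms(2)]] by (simp add: norm_mult)
    show "(\<lambda>x. norm (f x) * (\<Sum>\<^sub>\<infinity>y\<in>B. norm (g y))) summable_on A"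
      by (rule summable_on_cmult_left[OF assms(1)])
  qed auto
  then show "(\<lambda>(x, y). f x * g y) summable_on A \<times> B" by (rule abs_summable_summable)
qed

section \<open>The odd theta function and its product formula\<close>

text \<open>This is the function \<open>\<theta>[1, 1]\<close>, and the two that follow are \<open>\<theta>[0, 0]\<close> and \<open>\<theta>[1, 0]\<close> at the doubled
  arguments \<open>(2 x, 2 t)\<close>.\<close>

definition odd_theta :: "complex \<Rightarrow> complex \<Rightarrow> complex" where
  "odd_theta t z = theta_series (1/2) (z + 1/2) t"

definition theta_double0 :: "complex \<Rightarrow> complex \<Rightarrow> complex" where
  "theta_double0 t x = theta_series 0 (2 * x) (2 * t)"

definition theta_double1 :: "complex \<Rightarrow> complex \<Rightarrow> complex" where
  "theta_double1 t x = theta_series (1/2) (2 * x) (2 * t)"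

lemma has_sum_even_pairs:
  fixes F :: "int \<times> int \<Rightarrow> complex"
  assumes "((\<lambda>(a, b). F (a + b, a - b)) has_sum S) UNIV"
  shows "(F has_sum S) {(m, n). even (m + n)}"
proof -
  let ?j = "\<lambda>(a, b). (a + b, a - b :: int)"
  have "inj ?j" by (rule injI) auto
  moreover have "range ?j = {(m, n). even (m + n)}"
  proof (intro equalityI subsetI)
    fix q :: "int \<times> int" assume "q \<in> {(m, n). even (m + n)}"
    then have "even (fst q + snd q)" by (simp add: case_prod_unfold)
    then obtain k where "fst q + snd q = 2 * k" by (rule evenE)
    then have "q = ?j (k, fst q - k)" by (simp add: prod_eq_iff)
    then show "q \<in> range ?j" by (rule range_eqI)
  qed auto
  ultimately show ?thesis
    using assms has_sum_reindex[of ?j UNIV F S] by (simp add: o_def case_prod_unfold)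
qed

lemma has_sum_odd_pairs:
  fixes F :: "int \<times> int \<Rightarrow> complex"
  assumes "((\<lambda>(a, b). F (a + b, a - b - 1)) has_sum S) UNIV"
  shows "(F has_sum S) {(m, n). odd (m + n)}"
proof -
  let ?j = "\<lambda>(a, b). (a + b, a - b - 1 :: int)"
  have "inj ?j" by (rule injI) auto
  moreover have "range ?j = {(m, n). odd (m + n)}"
  proof (intro equalityI subsetI)
    fix q :: "int \<times> int" assume "q \<in> {(m, n). odd (m + n)}"
    then have "odd (fst q + snd q)" by (simp add: case_prod_unfold)
    then obtain k where "fst q + snd q = 2 * k + 1" by (rule oddE)
    then have "q = ?j (k + 1, fst q - k - 1)" by (simp add: prod_eq_iff)
    then show "q \<in> range ?j" by (rule range_eqI)
  qed auto
  ultimately show ?thesis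
    using assms has_sum_reindex[of ?j UNIV F S] by (simp add: o_def case_prod_unfold)
qed

text \<open>In the variables \<open>m + n\<close> and \<open>m - n\<close> the quadratic exponent of a product of two theta terms
  splits into one in \<open>x\<close> and one in \<open>y\<close>. The translation by \<open>1/2\<close> contributes the sign
  \<open>(-1) ^ (m + n + 1)\<close>: negative in the first lemma, positive in the second.\<close>

lemma theta_term_mult_even:
  "theta_term (1/2) (x + y + 1/2) t (a + b) * theta_term (1/2) (x - y + 1/2) t (a - b) =
     - (theta_term (1/2) (2 * x) (2 * t) a * theta_term 0 (2 * y) (2 * t) b)"
proof -
  have "theta_term (1/2) (x + y + 1/2) t (a + b) * theta_term (1/2) (x - y + 1/2) t (a - b) =
          theta_term (1/2) (2 * x) (2 * t) a * theta_term 0 (2 * y) (2 * t) b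
          * exp (2 * (of_int a * of_real pi * \<i>)) * exp (\<i> * pi)"
    unfolding theta_term_def exp_add[symmetric]
    by (rule arg_cong[where f = exp]) (simp add: power2_eq_square field_simps)
  then show ?thesis by (simp only: exp_2pi_int) simp
qed

lemma theta_term_mult_odd:
  "theta_term (1/2) (x + y + 1/2) t (a + b) * theta_term (1/2) (x - y + 1/2) t (a - b - 1) =
     theta_term 0 (2 * x) (2 * t) a * theta_term (1/2) (2 * y) (2 * t) b"
proof -
  have "theta_term (1/2) (x + y + 1/2) t (a + b) * theta_term (1/2) (x - y + 1/2) t (a - b - 1) =
          theta_term 0 (2 * x) (2 * t) a * theta_term (1/2) (2 * y) (2 * t) b
          * exp (2 * (of_int a * of_real pi * \<i>))"
    unfolding theta_term_def exp_add[symmetric]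
    by (rule arg_cong[where f = exp]) (simp add: power2_eq_square field_simps)
  then show ?thesis by (simp only: exp_2pi_int) simp
qed

text \<open>The left-hand side is a double sum over \<open>(m, n)\<close>, and the two parities of \<open>m + n\<close> give the two products
  on the right. The right-hand side is a two-by-two determinant, so every relation between such
  determinants becomes a relation for \<open>odd_theta\<close>.\<close>

lemma odd_theta_product:
  assumes "Im t > 0"
  shows "odd_theta t (x + y) * odd_theta t (x - y) =
           theta_double0 t x * theta_double1 t y - theta_double1 t x * theta_double0 t y"
proof -
  let ?F = "\<lambda>(m, n). theta_term (1/2) (x + y + 1/2) t m * theta_term (1/2) (x - y + 1/2) t n"
  have t2: "Im (2 * t) > 0" using assms by simp
  note summable = theta_term_norm_summable[OF assms] theta_term_norm_summable[OF t2]
  note series = odd_theta_def theta_double0_def theta_double1_def theta_series_def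
  have F: "(?F has_sum (odd_theta t (x + y) * odd_theta t (x - y))) UNIV"
    unfolding series UNIV_Times_UNIV[symmetric] by (intro has_sum_mult_Times summable)
  have "((\<lambda>p. - (case p of (a, b) \<Rightarrow> theta_term (1/2) (2 * x) (2 * t) a * theta_term 0 (2 * y) (2 * t) b))
          has_sum - (theta_double1 t x * theta_double0 t y)) UNIV"
    unfolding series UNIV_Times_UNIV[symmetric] by (intro has_sum_uminusI has_sum_mult_Times summable)
  then have even: "(?F has_sum - (theta_double1 t x * theta_double0 t y)) {(m, n). even (m + n)}"
    by (intro has_sum_even_pairs) (simp add: theta_term_mult_even case_prod_unfold)
  have "((\<lambda>(a, b). theta_term 0 (2 * x) (2 * t) a * theta_term (1/2) (2 * y) (2 * t) b)
          has_sum (theta_double0 t x * theta_double1 t y)) UNIV"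
    unfolding series UNIV_Times_UNIV[symmetric] by (intro has_sum_mult_Times summable)
  then have odd: "(?F has_sum (theta_double0 t x * theta_double1 t y)) {(m, n). odd (m + n)}"
    by (intro has_sum_odd_pairs) (simp add: theta_term_mult_odd case_prod_unfold)
  have "(?F has_sum (- (theta_double1 t x * theta_double0 t y) + theta_double0 t x * theta_double1 t y))
          ({(m, n). even (m + n)} \<union> {(m, n). odd (m + n)})"
    by (rule has_sum_Un_disjoint[OF even odd]) auto
  also have "{(m, n). even (m + n)} \<union> {(m, n). odd (m + n)} = (UNIV :: (int \<times> int) set)" by auto
  finally show ?thesis using has_sum_unique[OF F] by simp
qed

lemma odd_theta_uminus: "odd_theta t (- z) = - odd_theta t z"
proof -
  have "odd_theta t (- z) = theta_series (- (1/2)) (z - 1/2) t"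
    using theta_series_uminus[of "1/2" "- z + 1/2" t] by (simp add: odd_theta_def)
  also have "\<dots> = theta_series (1/2) (z - 1/2) t"
    using theta_series_char_plus_1[of "- (1/2)"] by simp
  also have "odd_theta t z = - \<dots>"
    using theta_series_plus_1[of "1/2" "z - 1/2" t] by (simp add: odd_theta_def add.commute)
  finally show ?thesis by simp
qed

lemma odd_theta_plus_1: "odd_theta t (z + 1) = - odd_theta t z"
  using theta_series_plus_1[of "1/2" "z + 1/2" t] by (simp add: odd_theta_def add_ac)

lemma odd_theta_plus_t: "odd_theta t (z + t) = - exp (- \<i> * pi * (t + 2 * z)) * odd_theta t z"
proof -
  have "odd_theta t z = theta_series (1/2 + 1) (z + 1/2) t"
    by (simp only: theta_series_char_plus_1 odd_theta_def)
  also have "\<dots> = exp (\<i> * pi * (t + 2 * z) + \<i> * pi) * odd_theta t (z + t)"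
    unfolding theta_series_add_char odd_theta_def by (simp add: algebra_simps)
  also have "\<dots> = - exp (\<i> * pi * (t + 2 * z)) * odd_theta t (z + t)"
    by (subst exp_add) simp
  finally have *: "odd_theta t z = - exp (\<i> * pi * (t + 2 * z)) * odd_theta t (z + t)" .
  have "exp (- \<i> * pi * (t + 2 * z)) * exp (\<i> * pi * (t + 2 * z)) = 1"
    by (simp flip: exp_add)
  then show ?thesis by (subst *) (simp add: mult.assoc[symmetric])
qed

lemma theta_series_eq_odd_theta:
  "theta_series a z t =
     exp (\<i> * pi * (of_real (a - 1/2) ^ 2 * t + 2 * of_real (a - 1/2) * z)) *
     odd_theta t (z + of_real (a - 1/2) * t - 1/2)"
  using theta_series_add_char[of "1/2" "a - 1/2" z t] by (simp add: odd_theta_def)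

section \<open>Logarithmic derivatives\<close>

definition log_deriv_theta :: "complex \<Rightarrow> complex \<Rightarrow> complex" where
  "log_deriv_theta t z = deriv (odd_theta t) z / odd_theta t z"

lemma odd_theta_holomorphic:
  assumes Im_pos: "Im t > 0"
  shows "odd_theta t holomorphic_on UNIV"
proof -
  have "((\<lambda>z. theta_series (1/2) z t) \<circ> (\<lambda>z. z + 1/2)) holomorphic_on UNIV"
    by (rule holomorphic_on_compose_gen[OF _ theta_series_holomorphic[OF Im_pos]])
       (auto intro!: holomorphic_intros)
  then show ?thesis by (simp add: odd_theta_def[abs_def] o_def)
qed

lemma odd_theta_has_deriv:
  assumes Im_pos: "Im t > 0"
  shows "(odd_theta t has_field_derivative deriv (odd_theta t) z) (at z)"
  using odd_theta_holomorphic[OF Im_pos] by (rule holomorphic_derivI) auto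

lemma odd_theta_has_deriv_chain [derivative_intros]:
  assumes "Im t > 0" "(f has_field_derivative f') (at z)"
  shows "((\<lambda>z. odd_theta t (f z)) has_field_derivative deriv (odd_theta t) (f z) * f') (at z)"
  using DERIV_chain2[OF odd_theta_has_deriv[OF assms(1)] assms(2)] .

lemma theta_double_has_deriv:
  assumes Im_pos: "Im t > 0"
  obtains g' h' where
    "\<And>x. (theta_double0 t has_field_derivative g' x) (at x)"
    "\<And>x. (theta_double1 t has_field_derivative h' x) (at x)"
proof -
  have t2: "Im (2 * t) > 0" using Im_pos by simp
  have "((\<lambda>z. theta_series a z (2 * t)) \<circ> (\<lambda>z. 2 * z)) holomorphic_on UNIV" for a
    by (rule holomorphic_on_compose_gen[OF _ theta_series_holomorphic[OF t2]])
       (auto intro!: holomorphic_intros)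
  then have "theta_double0 t holomorphic_on UNIV" "theta_double1 t holomorphic_on UNIV"
    by (simp_all add: theta_double0_def[abs_def] theta_double1_def[abs_def] o_def)
  then show ?thesis
    by (intro that[of "deriv (theta_double0 t)" "deriv (theta_double1 t)"] holomorphic_derivI) auto
qed

lemma odd_theta_0: "odd_theta t 0 = 0"
  using odd_theta_uminus[of t 0] by simp

text \<open>Write \<open>g\<close>, \<open>h\<close> for the two functions of the product formula. Each factor is a determinant of
  values of \<open>(g, h)\<close> and of its derivative, with the columns taken at \<open>y\<close>, \<open>u\<close> and \<open>0\<close>; for example
  \<open>\<theta>'(0) \<theta>(2 y)\<close> is the Wronskian \<open>g' h - h' g\<close> at \<open>y\<close>. The claim is then the Pluecker relation.\<close>

lemma odd_theta_derivative_identity: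
  assumes Im_pos: "Im t > 0"
  defines "T \<equiv> odd_theta t"
  shows "2 * deriv T y * T y * T (y + u) * T (y - u)
         - T y ^ 2 * (deriv T (y + u) * T (y - u) + T (y + u) * deriv T (y - u))
         = - deriv T 0 * T (2 * y) * T u ^ 2"
proof -
  obtain g' h' where g': "\<And>x. (theta_double0 t has_field_derivative g' x) (at x)"
    and h': "\<And>x. (theta_double1 t has_field_derivative h' x) (at x)"
    using theta_double_has_deriv[OF Im_pos] by metis
  let ?g = "theta_double0 t" and ?h = "theta_double1 t"
  have prod: "T (x + y) * T (x - y) = ?g x * ?h y - ?h x * ?g y" for x y
    unfolding T_def by (rule odd_theta_product[OF Im_pos])
  have D: "deriv T (x + v) * T (x - v) + T (x + v) * deriv T (x - v) = g' x * ?h v - h' x * ?g v" for x v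
  proof (rule DERIV_unique)
    show "((\<lambda>x. T (x + v) * T (x - v)) has_field_derivative
            deriv T (x + v) * T (x - v) + T (x + v) * deriv T (x - v)) (at x)"
      unfolding T_def by (auto intro!: derivative_eq_intros simp: Im_pos)
    show "((\<lambda>x. T (x + v) * T (x - v)) has_field_derivative g' x * ?h v - h' x * ?g v) (at x)"
      unfolding prod by (auto intro!: derivative_eq_intros g' h' simp: Im_pos)
  qed
  have T0: "T 0 = 0" by (simp add: T_def odd_theta_0)
  have Tu: "- (T u ^ 2) = ?g 0 * ?h u - ?h 0 * ?g u"
    using prod[of 0 u] by (simp add: T_def odd_theta_uminus power2_eq_square)
  have Ty: "T y ^ 2 = ?g y * ?h 0 - ?h y * ?g 0"
    using prod[of y 0] by (simp add: power2_eq_square)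
  have 2: "2 * deriv T y * T y = g' y * ?h 0 - h' y * ?g 0"
    using D[of y 0] by (simp add: mult_ac)
  have 3: "deriv T 0 * T (2 * y) = g' y * ?h y - h' y * ?g y"
    using D[of y y] T0 by (simp add: mult.commute)
  have "2 * deriv T y * T y * T (y + u) * T (y - u)
         - T y ^ 2 * (deriv T (y + u) * T (y - u) + T (y + u) * deriv T (y - u))
       = (2 * deriv T y * T y) * (T (y + u) * T (y - u))
         - T y ^ 2 * (deriv T (y + u) * T (y - u) + T (y + u) * deriv T (y - u))"
    by (simp only: mult.assoc)
  also have "\<dots> = (g' y * ?h 0 - h' y * ?g 0) * (?g y * ?h u - ?h y * ?g u)
         - (?g y * ?h 0 - ?h y * ?g 0) * (g' y * ?h u - h' y * ?g u)"
    unfolding D Ty 2 prod ..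
  also have "\<dots> = (g' y * ?h y - h' y * ?g y) * (?g 0 * ?h u - ?h 0 * ?g u)"
    by algebra
  also have "\<dots> = - deriv T 0 * T (2 * y) * T u ^ 2"
    unfolding 3[symmetric] Tu[symmetric] by simp
  finally show ?thesis .
qed

lemma log_deriv_theta_identity:
  assumes Im_pos: "Im t > 0"
  defines "T \<equiv> odd_theta t" and "Z \<equiv> log_deriv_theta t"
  assumes ne: "T y \<noteq> 0" "T (y + u) \<noteq> 0" "T (y - u) \<noteq> 0"
  shows "2 * Z y - Z (y + u) - Z (y - u) =
           - deriv T 0 * T (2 * y) * T u ^ 2 / (T y ^ 2 * T (y + u) * T (y - u))"
proof -
  have "2 * Z y - Z (y + u) - Z (y - u) =
     (2 * deriv T y * T y * T (y + u) * T (y - u)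
       - T y ^ 2 * (deriv T (y + u) * T (y - u) + T (y + u) * deriv T (y - u)))
     / (T y ^ 2 * T (y + u) * T (y - u))"
    using ne by (simp add: Z_def log_deriv_theta_def T_def field_simps power2_eq_square)
  also note odd_theta_derivative_identity[OF Im_pos, of y u, folded T_def]
  finally show ?thesis .
qed

section \<open>The zeros of the odd theta function\<close>

lemma odd_theta_not_identically_0:
  assumes Im_pos: "Im t > 0"
  shows "\<exists>z. odd_theta t z \<noteq> 0"
proof -
  obtain z where "theta_series 0 z t \<noteq> 0" using theta_series_not_identically_0[OF Im_pos] by blast
  then show ?thesis unfolding theta_series_eq_odd_theta[of 0] by auto
qed

text \<open>If \<open>\<theta>(w) = 0\<close>, the determinant of the vectors \<open>(g, h)\<close> at \<open>s + w\<close> and at \<open>s\<close> vanishes, so these vectors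
  are parallel and \<open>\<theta>(s + w + v) \<theta>(s + w - v) = r \<theta>(s + v) \<theta>(s - v)\<close> with \<open>r\<close> independent of \<open>v\<close>.
  The logarithmic derivative in \<open>v\<close> shows that \<open>\<theta>'/\<theta>(p + w) - \<theta>'/\<theta>(p)\<close> takes the same value at
  \<open>p = s + v\<close> and at \<open>p = s - v\<close>, hence is constant: \<open>\<theta>(p + w)/\<theta>(p)\<close> is an exponential.\<close>

lemma odd_theta_zero_translation_exponential:
  assumes Im_pos: "Im t > 0" and w: "odd_theta t w = 0"
  shows "\<exists>\<mu> C. \<forall>p. odd_theta t (p + w) = C * exp (\<mu> * p) * odd_theta t p"
proof -
  define T where "T = odd_theta t"
  have contT: "continuous_on UNIV T"
    unfolding T_def by (rule holomorphic_on_imp_continuous_on[OF odd_theta_holomorphic[OF Im_pos]])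
  have hol: "T holomorphic_on S" for S
    unfolding T_def by (rule holomorphic_on_subset[OF odd_theta_holomorphic[OF Im_pos]]) simp
  have hol_w: "(\<lambda>p. T (p + w)) holomorphic_on S" for S
    unfolding T_def holomorphic_on_def
    by (metis odd_theta_has_deriv_chain[OF Im_pos DERIV_ident[THEN DERIV_add, OF DERIV_const]]
        field_differentiable_def field_differentiable_at_within)
  obtain z0 where z0: "T z0 \<noteq> 0" using odd_theta_not_identically_0[OF Im_pos] by (auto simp: T_def)
  \<comment> \<open>Two entire functions that are not identically zero have a common point of nonvanishing.\<close>
  obtain p0 where p0: "T p0 \<noteq> 0" "T (p0 + w) \<noteq> 0"
  proof (rule ccontr)
    assume "\<not> thesis"
    then have 0: "T p = 0 \<or> T (p + w) = 0" for p using that by blast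
    define S where "S = {p. T p \<noteq> 0}"
    have S: "open S" unfolding S_def by (rule open_Collect_neq[OF contT continuous_on_const])
    have "T (z0 - w + w) = (\<lambda>_. 0) (z0 - w)"
      by (rule analytic_continuation_open[of S UNIV "\<lambda>p. T (p + w)" "\<lambda>_. 0"])
         (use S z0 0 in \<open>auto simp: S_def intro!: hol_w\<close>)
    then show False using z0 by simp
  qed
  define U where "U = {p. T p \<noteq> 0} \<inter> {p. T (p + w) \<noteq> 0}"
  have U: "open U" "p0 \<in> U" unfolding U_def using p0
    by (auto intro!: open_Int open_Collect_neq continuous_on_const contT holomorphic_on_imp_continuous_on[OF hol_w])
  then obtain \<epsilon> where \<epsilon>: "\<epsilon> > 0" "ball p0 \<epsilon> \<subseteq> U" by (rule openE)
  let ?g = "theta_double0 t" and ?h = "theta_double1 t"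
  have prod: "T (x + y) * T (x - y) = ?g x * ?h y - ?h x * ?g y" for x y
    unfolding T_def by (rule odd_theta_product[OF Im_pos])
  define R where "R p = deriv T (p + w) / T (p + w) - deriv T p / T p" for p
  have R: "R p = R p0" if p: "p \<in> U" for p
  proof -
    define s y where "s = (p + p0) / 2" and "y = (p - p0) / 2"
    have sy: "s + y = p" "s - y = p0" by (simp_all add: s_def y_def field_simps)
    have ne: "T p \<noteq> 0" "T (p + w) \<noteq> 0" using p by (auto simp: U_def)
    have par: "?g (s + w) * ?h s = ?h (s + w) * ?g s"
      using prod[of "s + w" s] w by (simp add: T_def algebra_simps)
    have "\<not> (?g s = 0 \<and> ?h s = 0)" using prod[of s y] ne p0 sy by auto
    then have "\<exists>r. ?g (s + w) = r * ?g s \<and> ?h (s + w) = r * ?h s"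
    proof (cases "?g s = 0")
      case True
      then show ?thesis using par \<open>\<not> (?g s = 0 \<and> ?h s = 0)\<close>
        by (intro exI[of _ "?h (s + w) / ?h s"]) simp
    next
      case False
      then show ?thesis using par
        by (intro exI[of _ "?g (s + w) / ?g s"]) (simp add: field_simps)
    qed
    then obtain r where r: "?g (s + w) = r * ?g s" "?h (s + w) = r * ?h s" by blast
    have eq: "T (s + w + v) * T (s + w - v) = r * (T (s + v) * T (s - v))" for v
      unfolding prod r by (simp add: algebra_simps)
    have D: "deriv T (s + w + y) * T (s + w - y) - T (s + w + y) * deriv T (s + w - y)
        = r * (deriv T (s + y) * T (s - y) - T (s + y) * deriv T (s - y))"
    proof (rule DERIV_unique)
      show "((\<lambda>v. T (s + w + v) * T (s + w - v)) has_field_derivative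
             deriv T (s + w + y) * T (s + w - y) - T (s + w + y) * deriv T (s + w - y)) (at y)"
        unfolding T_def by (auto intro!: derivative_eq_intros simp: Im_pos)
      show "((\<lambda>v. T (s + w + v) * T (s + w - v)) has_field_derivative
             r * (deriv T (s + y) * T (s - y) - T (s + y) * deriv T (s - y))) (at y)"
        unfolding eq unfolding T_def by (auto intro!: derivative_eq_intros simp: Im_pos)
    qed
    have e: "s + w + y = p + w" "s + w - y = p0 + w" using sy by (auto simp: algebra_simps)
    note D = D[unfolded e sy] and E = eq[of y, unfolded e sy]
    have "r \<noteq> 0" using E ne p0 by auto
    have "R p - R p0 = (deriv T (p + w) * T (p0 + w) - T (p + w) * deriv T (p0 + w)) / (T (p + w) * T (p0 + w))
       - (deriv T p * T p0 - T p * deriv T p0) / (T p * T p0)"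
      using ne p0 by (simp add: R_def field_simps)
    also have "\<dots> = 0" unfolding D E using \<open>r \<noteq> 0\<close> by simp
    finally show ?thesis by simp
  qed
  define \<mu> where "\<mu> = R p0"
  have "\<exists>C. \<forall>p\<in>ball p0 \<epsilon>. T (p + w) * exp (- \<mu> * p) / T p = C"
  proof (rule has_field_derivative_zero_constant)
    fix p assume "p \<in> ball p0 \<epsilon>"
    then have p: "p \<in> U" using \<epsilon> by auto
    then have ne: "T p \<noteq> 0" "T (p + w) \<noteq> 0" by (auto simp: U_def)
    have \<mu>: "\<mu> = deriv T (p + w) / T (p + w) - deriv T p / T p"
      using R[OF p] by (simp add: \<mu>_def R_def)
    have "((\<lambda>p. T (p + w) * exp (- \<mu> * p) / T p) has_field_derivative
       ((deriv T (p + w) * exp (- \<mu> * p) + T (p + w) * (exp (- \<mu> * p) * - \<mu>)) * T p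
          - T (p + w) * exp (- \<mu> * p) * deriv T p) / (T p * T p)) (at p)"
      using ne unfolding T_def by (auto intro!: derivative_eq_intros simp: Im_pos)
    also have "(deriv T (p + w) * exp (- \<mu> * p) + T (p + w) * (exp (- \<mu> * p) * - \<mu>)) * T p
          - T (p + w) * exp (- \<mu> * p) * deriv T p
       = exp (- \<mu> * p) * (deriv T (p + w) * T p - T (p + w) * T p * \<mu> - T (p + w) * deriv T p)"
      by (simp add: algebra_simps)
    also have "deriv T (p + w) * T p - T (p + w) * T p * \<mu> - T (p + w) * deriv T p = 0"
      unfolding \<mu> using ne by (simp add: field_simps)
    finally show "((\<lambda>p. T (p + w) * exp (- \<mu> * p) / T p) has_field_derivative 0) (at p within ball p0 \<epsilon>)"
      by (simp add: has_field_derivative_at_within)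
  qed auto
  then obtain C where C: "\<And>p. p \<in> ball p0 \<epsilon> \<Longrightarrow> T (p + w) * exp (- \<mu> * p) / T p = C" by blast
  have "T (p + w) = C * exp (\<mu> * p) * T p" for p
  proof (rule analytic_continuation_open[of "ball p0 \<epsilon>" UNIV "\<lambda>p. T (p + w)" "\<lambda>p. C * exp (\<mu> * p) * T p"])
    fix p assume p: "p \<in> ball p0 \<epsilon>"
    then have "T p \<noteq> 0" using \<epsilon> by (auto simp: U_def)
    then show "T (p + w) = C * exp (\<mu> * p) * T p"
      using C[OF p] by (auto simp: exp_minus field_simps)
  qed (use \<epsilon> in \<open>auto intro!: holomorphic_intros hol hol_w\<close>)
  then show ?thesis unfolding T_def by blast
qed

text \<open>Comparing the factors \<open>-1\<close> and \<open>- exp (- \<pi> \<i> (t + 2 p))\<close> acquired under the two periods on both sides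
  of \<open>\<theta>(p + w) = C exp (\<mu> p) \<theta>(p)\<close> gives \<open>exp \<mu> = 1\<close> and \<open>exp (\<mu> t + 2 \<pi> \<i> w) = 1\<close>.\<close>

lemma odd_theta_zeros_lattice:
  assumes Im_pos: "Im t > 0" and w: "odd_theta t w = 0"
  obtains k m :: int where "w = of_int k * t + of_int m"
proof -
  obtain \<mu> C where *: "\<And>p. odd_theta t (p + w) = C * exp (\<mu> * p) * odd_theta t p"
    using odd_theta_zero_translation_exponential[OF Im_pos w] by blast
  obtain z0 where z0: "odd_theta t z0 \<noteq> 0" using odd_theta_not_identically_0[OF Im_pos] by blast
  define p where "p = z0 - w"
  have ne: "odd_theta t (p + w) \<noteq> 0" using z0 by (simp add: p_def)
  then have ne': "C \<noteq> 0" "odd_theta t p \<noteq> 0" unfolding * by auto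
  have "odd_theta t (p + w) = C * exp (\<mu> * (p + 1)) * odd_theta t p"
    using *[of "p + 1"] odd_theta_plus_1[of t "p + w"] odd_theta_plus_1[of t p] by (simp add: add_ac)
  then have "exp \<mu> = 1" using *[of p] ne' by (simp add: algebra_simps exp_add)
  then obtain k :: int where k: "\<mu> = of_int (2 * k) * pi * \<i>"
    by (rule exp_eq_1_imp_2pi_int)
  have "exp (- \<i> * pi * (t + 2 * (p + w))) * odd_theta t (p + w)
        = C * exp (\<mu> * (p + t)) * exp (- \<i> * pi * (t + 2 * p)) * odd_theta t p"
    using *[of "p + t"] odd_theta_plus_t[of t "p + w"] odd_theta_plus_t[of t p] by (simp add: add_ac mult_ac)
  then have "exp (- \<i> * pi * (t + 2 * (p + w))) * exp (\<mu> * p) = exp (\<mu> * (p + t)) * exp (- \<i> * pi * (t + 2 * p))"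
    using *[of p] ne' by simp
  then have "exp (\<mu> * t + 2 * \<i> * pi * w) = 1"
    by (simp add: exp_minus exp_diff exp_add algebra_simps field_simps)
  then obtain m :: int where "\<mu> * t + 2 * \<i> * pi * w = of_int (2 * m) * pi * \<i>"
    by (rule exp_eq_1_imp_2pi_int)
  then have "(2 * \<i> * pi) * w = (2 * \<i> * pi) * (of_int (- k) * t + of_int m)"
    by (simp add: k algebra_simps)
  then show ?thesis using that[of "- k" m] by (subst (asm) mult_cancel_left) auto
qed

section \<open>Values at 5-torsion points\<close>

lemma log_deriv_theta_uminus:
  assumes Im_pos: "Im t > 0"
  shows "log_deriv_theta t (- z) = - log_deriv_theta t z"
proof -
  have "deriv (odd_theta t) (- z) = deriv (odd_theta t) z"
  proof (rule DERIV_unique)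
    show "((\<lambda>z. - odd_theta t (- z)) has_field_derivative deriv (odd_theta t) (- z)) (at z)"
      by (auto intro!: derivative_eq_intros simp: Im_pos)
    show "((\<lambda>z. - odd_theta t (- z)) has_field_derivative deriv (odd_theta t) z) (at z)"
      unfolding odd_theta_uminus by (auto intro!: derivative_eq_intros simp: Im_pos)
  qed
  then show ?thesis by (simp add: log_deriv_theta_def odd_theta_uminus)
qed

lemma log_deriv_theta_plus_1:
  assumes Im_pos: "Im t > 0"
  shows "log_deriv_theta t (z + 1) = log_deriv_theta t z"
proof -
  have "deriv (odd_theta t) (z + 1) = - deriv (odd_theta t) z"
  proof (rule DERIV_unique)
    show "((\<lambda>z. odd_theta t (z + 1)) has_field_derivative deriv (odd_theta t) (z + 1)) (at z)"
      by (auto intro!: derivative_eq_intros simp: Im_pos)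
    show "((\<lambda>z. odd_theta t (z + 1)) has_field_derivative - deriv (odd_theta t) z) (at z)"
      unfolding odd_theta_plus_1 by (auto intro!: derivative_eq_intros simp: Im_pos)
  qed
  then show ?thesis by (simp add: log_deriv_theta_def odd_theta_plus_1)
qed

lemma log_deriv_theta_plus_t:
  assumes Im_pos: "Im t > 0" and ne: "odd_theta t z \<noteq> 0"
  shows "log_deriv_theta t (z + t) = log_deriv_theta t z - 2 * pi * \<i>"
proof -
  define e where "e = exp (- \<i> * pi * (t + 2 * z))"
  have "deriv (odd_theta t) (z + t) = - e * (deriv (odd_theta t) z - 2 * pi * \<i> * odd_theta t z)"
  proof (rule DERIV_unique)
    show "((\<lambda>z. odd_theta t (z + t)) has_field_derivative deriv (odd_theta t) (z + t)) (at z)"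
      by (auto intro!: derivative_eq_intros simp: Im_pos)
    show "((\<lambda>z. odd_theta t (z + t)) has_field_derivative
             - e * (deriv (odd_theta t) z - 2 * pi * \<i> * odd_theta t z)) (at z)"
      unfolding odd_theta_plus_t e_def by (auto intro!: derivative_eq_intros simp: algebra_simps Im_pos)
  qed
  moreover have "odd_theta t (z + t) = - e * odd_theta t z" by (simp add: odd_theta_plus_t e_def)
  moreover have "e \<noteq> 0" by (simp add: e_def)
  ultimately show ?thesis using ne by (simp add: log_deriv_theta_def divide_simps)
qed

lemma odd_theta_plus_t_2: "odd_theta t (z + (t + 2)) = - exp (- \<i> * pi * (t + 2 * z)) * odd_theta t z"
  using odd_theta_plus_1[of t "z + t"] odd_theta_plus_1[of t "z + t + 1"] odd_theta_plus_t[of t z]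
  by (simp add: add_ac)

lemma log_deriv_theta_plus_t_2:
  assumes Im_pos: "Im t > 0" and ne: "odd_theta t z \<noteq> 0"
  shows "log_deriv_theta t (z + (t + 2)) = log_deriv_theta t z - 2 * pi * \<i>"
  using log_deriv_theta_plus_1[OF Im_pos, of "z + t"] log_deriv_theta_plus_1[OF Im_pos, of "z + t + 1"]
    log_deriv_theta_plus_t[OF Im_pos ne]
  by (simp add: add_ac)

text \<open>A lattice point has an integer multiple of \<open>Im t\<close> as its imaginary part, whereas
  \<open>Im (j w) = j/5 Im t\<close>.\<close>

lemma odd_theta_5_torsion_nonzero:
  assumes Im_pos: "Im t > 0" and w: "5 * w = t + 2"
  shows "odd_theta t w \<noteq> 0" "odd_theta t (2 * w) \<noteq> 0"
proof -
  have *: "odd_theta t (of_int j * w) \<noteq> 0" if j: "\<not> 5 dvd j" for j :: int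
  proof
    assume "odd_theta t (of_int j * w) = 0"
    then obtain k m :: int where km: "of_int j * w = of_int k * t + of_int m"
      using odd_theta_zeros_lattice[OF Im_pos] by blast
    have "of_int j * (t + 2) = 5 * (of_int k * t + of_int m)"
      using km w by (metis mult.left_commute)
    then have "Im (of_int j * (t + 2)) = Im (5 * (of_int k * t + of_int m))" by simp
    then have "of_int j * Im t = of_int (5 * k) * Im t" by simp
    then have "j = 5 * k" using Im_pos by (simp flip: of_int_mult)
    then show False using j by simp
  qed
  show "odd_theta t w \<noteq> 0" "odd_theta t (2 * w) \<noteq> 0" using *[of 1] *[of 2] by simp_all
qed

text \<open>The relation \<open>log_deriv_theta_identity\<close> at \<open>(y, u) = (w, 2 w)\<close> and at \<open>(2 w, w)\<close> involves only the multiples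
  of \<open>w\<close> from \<open>- w\<close> to \<open>4 w\<close>. Since \<open>5 w = t + 2\<close> is a quasi-period, \<open>3 w\<close> and \<open>4 w\<close> reduce to \<open>- 2 w\<close> and \<open>- w\<close>.\<close>

lemma log_deriv_theta_5_torsion:
  assumes Im_pos: "Im t > 0" and w: "5 * w = t + 2"
  defines "T \<equiv> odd_theta t" and "Z \<equiv> log_deriv_theta t"
  shows "3 * Z w + Z (2 * w) + 2 * pi * \<i> =
           deriv T 0 * exp (\<i> * pi * (t - 4 * w)) * T (2 * w) ^ 2 / T w ^ 3"
    and "3 * Z (2 * w) - Z w + 2 * pi * \<i> =
           - deriv T 0 * exp (- (2 * \<i> * pi * w)) * T w ^ 2 / T (2 * w) ^ 3"
proof -
  have ne: "T w \<noteq> 0" "T (2 * w) \<noteq> 0"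
    unfolding T_def by (rule odd_theta_5_torsion_nonzero[OF Im_pos w])+
  have shift: "3 * w = - (2 * w) + (t + 2)" "4 * w = - w + (t + 2)"
    by (simp_all add: w[symmetric])
  have T3: "T (3 * w) = exp (- (\<i> * pi * (t - 4 * w))) * T (2 * w)"
    unfolding shift(1) T_def odd_theta_plus_t_2 odd_theta_uminus by (simp add: algebra_simps)
  have T4: "T (4 * w) = exp (- (\<i> * pi * (t - 2 * w))) * T w"
    unfolding shift(2) T_def odd_theta_plus_t_2 odd_theta_uminus by (simp add: algebra_simps)
  have Z3: "Z (3 * w) = - Z (2 * w) - 2 * pi * \<i>"
    unfolding shift(1) Z_def using ne
    by (subst log_deriv_theta_plus_t_2[OF Im_pos]) (simp_all add: T_def odd_theta_uminus log_deriv_theta_uminus[OF Im_pos])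
  have neg: "T (- w) = - T w" "Z (- w) = - Z w"
    by (simp_all add: T_def Z_def odd_theta_uminus log_deriv_theta_uminus[OF Im_pos])
  have T3_ne: "T (3 * w) \<noteq> 0" using ne by (simp add: T3)
  note id = log_deriv_theta_identity[OF Im_pos, folded T_def Z_def]
  have "3 * Z w + Z (2 * w) + 2 * pi * \<i> = 2 * Z w - Z (w + 2 * w) - Z (w - 2 * w)"
    using Z3 neg by simp
  also have "\<dots> = - deriv T 0 * T (2 * w) * T (2 * w) ^ 2 / (T w ^ 2 * T (3 * w) * T (- w))"
    using id[of w "2 * w"] ne T3_ne neg by simp
  also have "\<dots> = deriv T 0 * exp (\<i> * pi * (t - 4 * w)) * T (2 * w) ^ 2 / T w ^ 3"
    unfolding T3 neg exp_minus using ne by (simp add: field_simps power3_eq_cube power2_eq_square)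
  finally show "3 * Z w + Z (2 * w) + 2 * pi * \<i> = \<dots>" .
  have "3 * Z (2 * w) - Z w + 2 * pi * \<i> = 2 * Z (2 * w) - Z (2 * w + w) - Z (2 * w - w)"
    using Z3 by simp
  also have "\<dots> = - deriv T 0 * T (4 * w) * T w ^ 2 / (T (2 * w) ^ 2 * T (3 * w) * T w)"
    using id[of "2 * w" w] ne T3_ne by simp
  also have "T (4 * w) = exp (- (2 * \<i> * pi * w)) * exp (- (\<i> * pi * (t - 4 * w))) * T w"
    unfolding T4 exp_add[symmetric] by (simp add: algebra_simps)
  also have "- deriv T 0 * \<dots> * T w ^ 2 / (T (2 * w) ^ 2 * T (3 * w) * T w)
      = - deriv T 0 * exp (- (2 * \<i> * pi * w)) * T w ^ 2 / T (2 * w) ^ 3"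
    unfolding T3 using ne by (simp add: field_simps power3_eq_cube power2_eq_square)
  finally show "3 * Z (2 * w) - Z w + 2 * pi * \<i> = \<dots>" .
qed

text \<open>The theta constants with characteristics \<open>(1/5, 7/5)\<close> and \<open>(3/5, 1/5)\<close> are translates of
  \<open>odd_theta\<close> to \<open>1 - 2 w\<close> and \<open>- w\<close>, where \<open>w = (t + 2) / 5\<close>.\<close>

lemma theta_const_1_5_7_5:
  assumes Im_pos: "Im t > 0" and w: "5 * w = t + 2"
  defines "c \<equiv> exp (\<i> * pi * (4 / 25 * t - 14 / 25))"
  shows "theta_const (1/5) (7/5) t = c * odd_theta t (2 * w)"
    and "theta_deriv_const (1/5) (7/5) t = theta_const (1/5) (7/5) t * (- (4/5 * pi * \<i>) - log_deriv_theta t (2 * w))"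
proof -
  have ne: "odd_theta t (2 * w) \<noteq> 0" by (rule odd_theta_5_torsion_nonzero[OF Im_pos w])
  have t: "t = 5 * w - 2" using w by (simp add: algebra_simps)
  have *: "theta_char (1/5) (7/5) z t = c * (exp (- (4/5 * \<i> * pi * z)) * odd_theta t (2 * w - z))" for z
  proof -
    have "odd_theta t (z + 7/10 + of_real (1/10 - 1/2) * t - 1/2) = odd_theta t (- (2 * w - z) + 1)"
      by (rule arg_cong[where f = "odd_theta t"]) (simp add: t field_simps)
    also have "\<dots> = odd_theta t (2 * w - z)" by (simp only: odd_theta_plus_1 odd_theta_uminus) simp
    finally have shifted: "odd_theta t (z + 7/10 + of_real (1/10 - 1/2) * t - 1/2) = odd_theta t (2 * w - z)" .
    have exps: "exp (\<i> * pi * (of_real (1/10 - 1/2) ^ 2 * t + 2 * of_real (1/10 - 1/2) * (z + 7/10)))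
            = c * exp (- (4/5 * \<i> * pi * z))"
      unfolding c_def minus_minus exp_add[symmetric]
      by (rule arg_cong[where f = exp]) (simp add: field_simps power2_eq_square)
    have "theta_char (1/5) (7/5) z t = theta_series (1/10) (z + 7/10) t"
      by (simp add: theta_char_eq_series)
    then show ?thesis
      unfolding theta_series_eq_odd_theta[of "1/10"] shifted exps by simp
  qed
  show 1: "theta_const (1/5) (7/5) t = c * odd_theta t (2 * w)"
    by (simp add: theta_const_def *)
  have "((\<lambda>z. theta_char (1/5) (7/5) z t) has_field_derivative
     c * (- (4/5 * \<i> * pi) * odd_theta t (2 * w) - deriv (odd_theta t) (2 * w))) (at 0)"
    unfolding * by (auto intro!: derivative_eq_intros simp: Im_pos)
  then show "theta_deriv_const (1/5) (7/5) t = theta_const (1/5) (7/5) t * (- (4/5 * pi * \<i>) - log_deriv_theta t (2 * w))"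
    unfolding theta_deriv_const_def 1 using ne
    by (subst DERIV_imp_deriv) (auto simp: log_deriv_theta_def field_simps)
qed

lemma theta_const_3_5_1_5:
  assumes Im_pos: "Im t > 0" and w: "5 * w = t + 2"
  defines "c \<equiv> - exp (\<i> * pi * (t / 25 - 1 / 25))"
  shows "theta_const (3/5) (1/5) t = c * odd_theta t w"
    and "theta_deriv_const (3/5) (1/5) t = theta_const (3/5) (1/5) t * (- (2/5 * pi * \<i>) - log_deriv_theta t w)"
proof -
  have ne: "odd_theta t w \<noteq> 0" by (rule odd_theta_5_torsion_nonzero[OF Im_pos w])
  have t: "t = 5 * w - 2" using w by (simp add: algebra_simps)
  have *: "theta_char (3/5) (1/5) z t = c * (exp (- (2/5 * \<i> * pi * z)) * odd_theta t (w - z))" for z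
  proof -
    have "odd_theta t (z + 1/10 + of_real (3/10 - 1/2) * t - 1/2) = odd_theta t (- (w - z))"
      by (rule arg_cong[where f = "odd_theta t"]) (simp add: t field_simps)
    also have "\<dots> = - odd_theta t (w - z)" by (rule odd_theta_uminus)
    finally have shifted: "odd_theta t (z + 1/10 + of_real (3/10 - 1/2) * t - 1/2) = - odd_theta t (w - z)" .
    have exps: "exp (\<i> * pi * (of_real (3/10 - 1/2) ^ 2 * t + 2 * of_real (3/10 - 1/2) * (z + 1/10)))
            = - c * exp (- (2/5 * \<i> * pi * z))"
      unfolding c_def minus_minus exp_add[symmetric]
      by (rule arg_cong[where f = exp]) (simp add: field_simps power2_eq_square)
    have "theta_char (3/5) (1/5) z t = theta_series (3/10) (z + 1/10) t"
      by (simp add: theta_char_eq_series)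
    then show ?thesis
      unfolding theta_series_eq_odd_theta[of "3/10"] shifted exps by simp
  qed
  show 1: "theta_const (3/5) (1/5) t = c * odd_theta t w"
    by (simp add: theta_const_def *)
  have "((\<lambda>z. theta_char (3/5) (1/5) z t) has_field_derivative
     c * (- (2/5 * \<i> * pi) * odd_theta t w - deriv (odd_theta t) w)) (at 0)"
    unfolding * by (auto intro!: derivative_eq_intros simp: Im_pos)
  then show "theta_deriv_const (3/5) (1/5) t = theta_const (3/5) (1/5) t * (- (2/5 * pi * \<i>) - log_deriv_theta t w)"
    unfolding theta_deriv_const_def 1 using ne
    by (subst DERIV_imp_deriv) (auto simp: log_deriv_theta_def field_simps)
qed

lemma theta_deriv_const_1_1: "theta_deriv_const 1 1 t = deriv (odd_theta t) 0"
  unfolding theta_deriv_const_def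
  by (rule arg_cong[where f = "\<lambda>f. deriv f 0"]) (simp add: theta_char_eq_series odd_theta_def fun_eq_iff)

theorem theorem4p5:
  fixes \<tau> :: complex
  assumes "Im \<tau> > 0"
  shows "theta_deriv_const (1/5) (7/5) \<tau> / theta_const (1/5) (7/5) \<tau> =
           - root_zeta 5 * theta_deriv_const 1 1 \<tau> *
           ((theta_const (1/5) (7/5) \<tau> ^ 5 - 3 * root_zeta 5 ^ 3 * theta_const (3/5) (1/5) \<tau> ^ 5) /
            (10 * theta_const (1/5) (7/5) \<tau> ^ 3 * theta_const (3/5) (1/5) \<tau> ^ 3))
       \<and> theta_deriv_const (3/5) (1/5) \<tau> / theta_const (3/5) (1/5) \<tau> =
           - root_zeta 5 * theta_deriv_const 1 1 \<tau> *
           ((3 * theta_const (1/5) (7/5) \<tau> ^ 5 + root_zeta 5 ^ 3 * theta_const (3/5) (1/5) \<tau> ^ 5) /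
            (10 * theta_const (1/5) (7/5) \<tau> ^ 3 * theta_const (3/5) (1/5) \<tau> ^ 3))"
proof -
  define w where "w = (\<tau> + 2) / 5"
  have w: "5 * w = \<tau> + 2" by (simp add: w_def)
  have \<tau>: "\<tau> = 5 * w - 2" using w by (simp add: algebra_simps)
  define A B \<theta>' where "A = theta_const (1/5) (7/5) \<tau>" and "B = theta_const (3/5) (1/5) \<tau>"
    and "\<theta>' = theta_deriv_const 1 1 \<tau>"
  define a b where "a = theta_deriv_const (1/5) (7/5) \<tau> / A" and "b = theta_deriv_const (3/5) (1/5) \<tau> / B"
  define \<alpha> \<beta> where "\<alpha> = exp (\<i> * pi * (4 / 25 * \<tau> - 14 / 25))" and "\<beta> = exp (\<i> * pi * (\<tau> / 25 - 1 / 25))"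
  let ?T = "odd_theta \<tau>" and ?Z = "log_deriv_theta \<tau>" and ?\<zeta> = "root_zeta 5"
  have T_ne: "?T w \<noteq> 0" "?T (2 * w) \<noteq> 0"
    by (rule odd_theta_5_torsion_nonzero[OF assms w])+
  have A: "A = \<alpha> * ?T (2 * w)" and B: "B = - \<beta> * ?T w"
    unfolding A_def B_def \<alpha>_def \<beta>_def
    by (rule theta_const_1_5_7_5(1)[OF assms w] theta_const_3_5_1_5(1)[OF assms w])+
  have coef_ne: "\<alpha> \<noteq> 0" "\<beta> \<noteq> 0" by (simp_all add: \<alpha>_def \<beta>_def)
  have ne: "A \<noteq> 0" "B \<noteq> 0" using T_ne coef_ne by (auto simp: A B)
  have a: "a = - (4/5 * pi * \<i>) - ?Z (2 * w)"
    unfolding a_def theta_const_1_5_7_5(2)[OF assms w, folded A_def] using ne by simp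
  have b: "b = - (2/5 * pi * \<i>) - ?Z w"
    unfolding b_def theta_const_3_5_1_5(2)[OF assms w, folded B_def] using ne by simp
  have \<theta>': "\<theta>' = deriv ?T 0" by (simp add: \<theta>'_def theta_deriv_const_1_1)
  have \<zeta>: "?\<zeta> = exp (\<i> * pi * (2 / 5))" by (simp add: root_zeta_def algebra_simps)
  have "a + 3 * b = - (3 * ?Z w + ?Z (2 * w) + 2 * pi * \<i>)" by (simp add: a b algebra_simps)
  also have "\<dots> = - \<theta>' * (exp (\<i> * pi * (\<tau> - 4 * w)) * ?T (2 * w) ^ 2 / ?T w ^ 3)"
    unfolding log_deriv_theta_5_torsion(1)[OF assms w] \<theta>' by simp
  also have "exp (\<i> * pi * (\<tau> - 4 * w)) * ?T (2 * w) ^ 2 / ?T w ^ 3 = ?\<zeta> * A ^ 2 / B ^ 3"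
  proof -
    have "?\<zeta> * \<alpha> ^ 2 = exp (\<i> * pi) * \<beta> ^ 3 * exp (\<i> * pi * (\<tau> - 4 * w))"
      unfolding \<zeta> \<alpha>_def \<beta>_def exp_of_nat_mult[symmetric] exp_add[symmetric]
      by (rule arg_cong[where f = exp]) (simp add: \<tau> field_simps)
    then have "?\<zeta> * \<alpha> ^ 2 = - (\<beta> ^ 3) * exp (\<i> * pi * (\<tau> - 4 * w))" by simp
    moreover have "?\<zeta> * A ^ 2 / B ^ 3 = (?\<zeta> * \<alpha> ^ 2) * ?T (2 * w) ^ 2 / - (\<beta> ^ 3 * ?T w ^ 3)"
      by (simp add: A B power_mult_distrib)
    ultimately show ?thesis using coef_ne by simp
  qed
  finally have 1: "a + 3 * b = - \<theta>' * (?\<zeta> * A ^ 2 / B ^ 3)" .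
  have "b - 3 * a = 3 * ?Z (2 * w) - ?Z w + 2 * pi * \<i>" by (simp add: a b algebra_simps)
  also have "\<dots> = - \<theta>' * (exp (- (2 * \<i> * pi * w)) * ?T w ^ 2 / ?T (2 * w) ^ 3)"
    unfolding log_deriv_theta_5_torsion(2)[OF assms w] \<theta>' by simp
  also have "exp (- (2 * \<i> * pi * w)) * ?T w ^ 2 / ?T (2 * w) ^ 3 = ?\<zeta> ^ 4 * B ^ 2 / A ^ 3"
  proof -
    \<comment> \<open>The exponents of \<open>\<zeta>\<^sub>5\<^sup>4 \<beta>\<^sup>2\<close> and \<open>\<alpha>\<^sup>3 exp (- 2 \<pi> \<i> w)\<close> differ by \<open>4 \<pi> \<i>\<close>.\<close>
    have "?\<zeta> ^ 4 * \<beta> ^ 2 = exp (2 * (of_int 2 * of_real pi * \<i>)) * \<alpha> ^ 3 * exp (- (2 * \<i> * pi * w))"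
      unfolding \<zeta> \<alpha>_def \<beta>_def exp_of_nat_mult[symmetric] exp_add[symmetric]
      by (rule arg_cong[where f = exp]) (simp add: \<tau> field_simps)
    then have "?\<zeta> ^ 4 * \<beta> ^ 2 = \<alpha> ^ 3 * exp (- (2 * \<i> * pi * w))" by (simp only: exp_2pi_int) simp
    then show ?thesis using T_ne coef_ne
      by (simp add: A B power_mult_distrib field_simps)
  qed
  finally have 2: "b - 3 * a = - \<theta>' * (?\<zeta> ^ 4 * B ^ 2 / A ^ 3)" .
  \<comment> \<open>The linear system for \<open>a\<close> and \<open>b\<close> has determinant 10, the denominator of the claim.\<close>
  have "a * (10 * A ^ 3 * B ^ 3) = - ?\<zeta> * \<theta>' * (A ^ 5 - 3 * ?\<zeta> ^ 3 * B ^ 5)"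
    "b * (10 * A ^ 3 * B ^ 3) = - ?\<zeta> * \<theta>' * (3 * A ^ 5 + ?\<zeta> ^ 3 * B ^ 5)"
    using 1 2 ne by (simp_all add: divide_simps split: if_splits) algebra+
  moreover have "10 * A ^ 3 * B ^ 3 \<noteq> 0" using ne by simp
  ultimately have "a = - ?\<zeta> * \<theta>' * ((A ^ 5 - 3 * ?\<zeta> ^ 3 * B ^ 5) / (10 * A ^ 3 * B ^ 3))"
    "b = - ?\<zeta> * \<theta>' * ((3 * A ^ 5 + ?\<zeta> ^ 3 * B ^ 5) / (10 * A ^ 3 * B ^ 3))"
    unfolding times_divide_eq_right by (metis eq_divide_imp)+
  then show ?thesis unfolding a_def b_def A_def B_def \<theta>'_def by blast
qed

end
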